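(* Let $f$ be a biarithmetic IASI of a graph $G$. Then $f$ is a strong IASI of $G$ (i.e. $|f^+(uv)|=|f(u)|\,|f(v)|$ for every edge $uv$) if and only if for every edge $uv$ of $G$, where $u$ is the end vertex with the smaller deterministic index, the deterministic ratio of $uv$ equals $|f(u)|$.
   Context: All graphs are simple and finite with no isolated vertices. Let $\mathbb{N}_0$ be the set of non-negative integers and $\mathcal{P}(\mathbb{N}_0)$ its power set; label sets are finite and non-empty. For sets $A,B$, $A+B=\{a+b: a\in A, b\in B\}$. An integer additive set-indexer (IASI) of $G$ is an injective map $f:V(G)\to\mathcal{P}(\mathbb{N}_0)$ such that $f^+:E(G)\to\mathcal{P}(\mathbb{N}_0)$, $f^+(uv)=f(u)+f(v)$, is also injective. An AP-set is a finite set of integers with at least three elements forming an arithmetic progression; its common difference is the deterministic index of the element it labels. An IASI is arithmetic if all vertex labels and edge labels are AP-sets. The deterministic ratio of an edge is the ratio ($\ge 1$) of the larger to the smaller deterministic index of its end vertices. A biarithmetic IASI is an arithmetic IASI $f$ such that for every edge $uv$, writing $d_u\le d_v$ for the deterministic indices of its ends, $d_v=k\,d_u$ for some integer $k$ with $1<k\le |f(u)|$ (so $d_u<d_v$). *)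

theory Defs
  imports Complex_Main "HOL-Library.Set_Algebras"
begin

definition simple_graph :: "'a set \<Rightarrow> 'a set set \<Rightarrow> bool" where
  "simple_graph V E \<longleftrightarrow>
     finite V \<and> (\<forall>e\<in>E. e \<subseteq> V \<and> card e = 2) \<and> (\<forall>v\<in>V. \<exists>e\<in>E. v \<in> e)"

text \<open>The addition on sets is the sumset operation of \<^theory>\<open>HOL-Library.Set_Algebras\<close>, so
  summing the labels over a two-element edge gives the sumset of the labels of its ends.\<close>

definition edge_label :: "('a \<Rightarrow> nat set) \<Rightarrow> 'a set \<Rightarrow> nat set" where
  "edge_label f e = (\<Sum>v\<in>e. f v)"

lemma edge_label_doubleton:
  assumes "u \<noteq> v"
  shows "edge_label f {u, v} = {a + b | a b. a \<in> f u \<and> b \<in> f v}"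
  using assms by (auto simp: edge_label_def set_plus_def)

definition iasi :: "'a set \<Rightarrow> 'a set set \<Rightarrow> ('a \<Rightarrow> nat set) \<Rightarrow> bool" where
  "iasi V E f \<longleftrightarrow>
     (\<forall>v\<in>V. finite (f v) \<and> f v \<noteq> {}) \<and> inj_on f V \<and> inj_on (edge_label f) E"

definition strong_iasi :: "'a set \<Rightarrow> 'a set set \<Rightarrow> ('a \<Rightarrow> nat set) \<Rightarrow> bool" where
  "strong_iasi V E f \<longleftrightarrow> iasi V E f \<and>
     (\<forall>u v. {u, v} \<in> E \<longrightarrow> card (edge_label f {u, v}) = card (f u) * card (f v))"

definition is_progression :: "nat set \<Rightarrow> nat \<Rightarrow> bool" where
  "is_progression A d \<longleftrightarrow> 0 < d \<and> (\<exists>a n. A = (\<lambda>i. a + i * d) ` {..<n})"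

definition ap_set :: "nat set \<Rightarrow> bool" where
  "ap_set A \<longleftrightarrow> finite A \<and> 3 \<le> card A \<and> (\<exists>d. is_progression A d)"

definition det_index :: "nat set \<Rightarrow> nat" where
  "det_index A = (THE d. is_progression A d)"

lemma is_progression_unique:
  assumes "is_progression A d" "is_progression A d'" "2 \<le> card A"
  shows "d = d'"
proof -
  have least: "Min (A - {Min A}) = Min A + c" if "is_progression A c" for c
  proof -
    from that obtain a n where c: "0 < c" and A: "A = (\<lambda>i. a + i * c) ` {..<n}"
      by (auto simp: is_progression_def)
    have "card A \<le> n" using card_image_le[of "{..<n}" "\<lambda>i. a + i * c"] A by simp
    with assms(3) have n: "2 \<le> n" by simp
    have m: "Min A = a"
      using n by (intro Min_eqI) (auto simp: A image_iff intro!: bexI[of _ 0])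
    have "Min (A - {a}) = a + c"
    proof (rule Min_eqI)
      show "finite (A - {a})" by (simp add: A)
      show "a + c \<in> A - {a}" using n c by (auto simp: A image_iff intro!: bexI[of _ 1])
      fix y assume "y \<in> A - {a}"
      then obtain i where "y = a + i * c" "i \<noteq> 0" by (auto simp: A)
      then show "a + c \<le> y" by (cases i) auto
    qed
    with m show ?thesis by simp
  qed
  from least[OF assms(1)] least[OF assms(2)] show ?thesis by simp
qed

lemma det_index_eq:
  assumes "is_progression A d" "2 \<le> card A"
  shows "det_index A = d"
  unfolding det_index_def using assms is_progression_unique by blast

definition arithmetic_iasi :: "'a set \<Rightarrow> 'a set set \<Rightarrow> ('a \<Rightarrow> nat set) \<Rightarrow> bool" where
  "arithmetic_iasi V E f \<longleftrightarrow>
     iasi V E f \<and> (\<forall>v\<in>V. ap_set (f v)) \<and> (\<forall>e\<in>E. ap_set (edge_label f e))"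

definition det_ratio :: "('a \<Rightarrow> nat set) \<Rightarrow> 'a set \<Rightarrow> rat" where
  "det_ratio f e =
     of_nat (Max ((\<lambda>v. det_index (f v)) ` e)) / of_nat (Min ((\<lambda>v. det_index (f v)) ` e))"

definition biarithmetic_iasi :: "'a set \<Rightarrow> 'a set set \<Rightarrow> ('a \<Rightarrow> nat set) \<Rightarrow> bool" where
  "biarithmetic_iasi V E f \<longleftrightarrow> arithmetic_iasi V E f \<and>
     (\<forall>u v. {u, v} \<in> E \<and> det_index (f u) \<le> det_index (f v) \<longrightarrow>
        (\<exists>k. 1 < k \<and> k \<le> card (f u) \<and> det_index (f v) = k * det_index (f u)))"

end

theory Submission
  imports Defs
begin

text \<open>If \<open>f u\<close> has \<open>m\<close> elements with difference \<open>d\<close> and \<open>f v\<close> has \<open>n\<close> elements with difference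
  \<open>k * d\<close>, where \<open>k \<le> m\<close>, then the translates of \<open>f u\<close> making up the sumset leave no gaps, so the
  sumset is a progression with \<open>m + k * (n - 1)\<close> elements. This equals \<open>m * n\<close> exactly when
  \<open>k = m\<close>, because \<open>n > 1\<close>.\<close>

text \<open>A positive difference makes the parametrization injective, so the unnamed length in
  \<open>is_progression\<close> can only be the cardinality.\<close>

lemma is_progression_card:
  assumes "is_progression A d"
  obtains a where "0 < d" "A = (\<lambda>i. a + i * d) ` {..<card A}"
proof -
  from assms obtain a n where d: "0 < d" and A: "A = (\<lambda>i. a + i * d) ` {..<n}"
    by (auto simp: is_progression_def)
  have "inj_on (\<lambda>i. a + i * d) {..<n}"
    using d by (auto intro: inj_onI)
  then have "card A = n"
    by (simp add: A card_image)
  with A have "A = (\<lambda>i. a + i * d) ` {..<card A}" by simp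
  with d show ?thesis by (rule that)
qed

lemma ap_set_is_progression_det_index:
  assumes "ap_set A"
  shows "is_progression A (det_index A)"
proof -
  from assms obtain d where "is_progression A d" "3 \<le> card A"
    by (auto simp: ap_set_def)
  then show ?thesis using det_index_eq[of A d] by simp
qed

text \<open>For fixed \<open>j\<close> the values form a block of \<open>m\<close> consecutive
  numbers starting at \<open>j * k\<close>. As \<open>k \<le> m\<close>, each block reaches at least
  up to the start of the next, and the last one starts at \<open>(n - 1) * k\<close>.\<close>

lemma sum_multiples_eq_lessThan:
  fixes k m n :: nat
  assumes "0 < k" "k \<le> m" "0 < n"
  shows "{i + j * k | i j. i < m \<and> j < n} = {..<m + k * (n - 1)}"
proof (intro equalityI subsetI)
  fix t assume "t \<in> {i + j * k | i j. i < m \<and> j < n}"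
  then obtain i j where t: "t = i + j * k" and i: "i < m" and j: "j < n" by blast
  from j have "j * k \<le> (n - 1) * k" by (intro mult_le_mono1) simp
  with t i have "t < m + (n - 1) * k" by linarith
  then show "t \<in> {..<m + k * (n - 1)}" by (simp add: mult.commute)
next
  fix t assume "t \<in> {..<m + k * (n - 1)}"
  then have t: "t < m + k * (n - 1)" by simp
  show "t \<in> {i + j * k | i j. i < m \<and> j < n}"
  \<comment> \<open>Division by \<open>k\<close> gives a valid \<open>j\<close> as long as the
    quotient is below \<open>n\<close>; the remainder is then below \<open>k \<le> m\<close>. Any
    larger \<open>t\<close> lies in the last block, so \<open>j = n - 1\<close> serves.\<close>
  proof (cases "t div k < n")
    case True
    have "t = t mod k + t div k * k" by simp
    moreover have "t mod k < m"
      using assms by (meson mod_less_divisor order_less_le_trans)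
    ultimately show ?thesis using True by blast
  next
    case False
    then have "(n - 1) * k \<le> t div k * k" by (intro mult_le_mono1) simp
    also have "\<dots> \<le> t" by simp
    finally have "t = (t - (n - 1) * k) + (n - 1) * k" "t - (n - 1) * k < m"
      using t by (auto simp: mult.commute)
    moreover have "n - 1 < n" using assms by simp
    ultimately show ?thesis by blast
  qed
qed

lemma card_sumset_progressions:
  assumes A: "is_progression A d" and B: "is_progression B (k * d)"
    and k: "k \<le> card A" and B0: "0 < card B"
  shows "card {x + y | x y. x \<in> A \<and> y \<in> B} = card A + k * (card B - 1)"
proof -
  from A obtain a where d: "0 < d" and Aeq: "A = (\<lambda>i. a + i * d) ` {..<card A}"
    by (rule is_progression_card)
  from B obtain b where kd: "0 < k * d" and Beq: "B = (\<lambda>j. b + j * (k * d)) ` {..<card B}"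
    by (rule is_progression_card)
  have memA: "x \<in> A \<longleftrightarrow> (\<exists>i<card A. x = a + i * d)" for x
    by (subst Aeq) auto
  have memB: "y \<in> B \<longleftrightarrow> (\<exists>j<card B. y = b + j * (k * d))" for y
    by (subst Beq) auto
  \<comment> \<open>Both differences are multiples of \<open>d\<close>, so the sumset is the image
    under \<open>?h\<close> of the index set \<open>i + j * k\<close>. Since \<open>0 < d\<close>,
    \<open>?h\<close> is injective and preserves the count.\<close>
  let ?h = "\<lambda>t. a + b + t * d"
  have h: "?h (i + j * k) = (a + i * d) + (b + j * (k * d))" for i j
    by (simp add: algebra_simps)
  have "{x + y | x y. x \<in> A \<and> y \<in> B} = ?h ` {i + j * k | i j. i < card A \<and> j < card B}"
  proof (intro equalityI subsetI)
    fix z assume "z \<in> {x + y | x y. x \<in> A \<and> y \<in> B}"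
    then obtain i j where "i < card A" "j < card B" "z = ?h (i + j * k)"
      unfolding memA memB h by blast
    then show "z \<in> ?h ` {i + j * k | i j. i < card A \<and> j < card B}" by blast
  next
    fix z assume "z \<in> ?h ` {i + j * k | i j. i < card A \<and> j < card B}"
    then obtain i j where "i < card A" "j < card B" "z = ?h (i + j * k)" by blast
    then show "z \<in> {x + y | x y. x \<in> A \<and> y \<in> B}"
      unfolding memA memB h by blast
  qed
  also have "\<dots> = ?h ` {..<card A + k * (card B - 1)}"
    using kd k B0 by (subst sum_multiples_eq_lessThan) auto
  finally have eq: "{x + y | x y. x \<in> A \<and> y \<in> B} = ?h ` {..<card A + k * (card B - 1)}" .
  have "inj_on ?h {..<card A + k * (card B - 1)}"
    using d by (auto intro: inj_onI)
  then show ?thesis unfolding eq by (simp add: card_image)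
qed

lemma card_sumset_progressions_eq_mult_iff:
  assumes "is_progression A d" "is_progression B (k * d)" "k \<le> card A" "1 < card B"
  shows "card {x + y | x y. x \<in> A \<and> y \<in> B} = card A * card B \<longleftrightarrow> k = card A"
proof -
  \<comment> \<open>This form removes the truncated subtraction: the equation becomes
    \<open>card A + k * n = card A * Suc n\<close>, where \<open>card A\<close> and then the factor
    \<open>n > 0\<close> cancel.\<close>
  obtain n where n: "card B = Suc n" "0 < n"
    using assms(4) by (cases "card B") auto
  have "card {x + y | x y. x \<in> A \<and> y \<in> B} = card A + k * n"
    using card_sumset_progressions[OF assms(1-3)] n by simp
  then show ?thesis using n by simp
qed

lemma det_ratio_doubleton:
  assumes "det_index (f v) = k * det_index (f u)" "0 < det_index (f u)" "0 < k"
  shows "det_ratio f {u, v} = of_nat k"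
proof -
  have "det_index (f u) \<le> det_index (f v)" using assms by simp
  then show ?thesis
    using assms by (simp add: det_ratio_def max_absorb2 min_absorb1)
qed

text \<open>The definition of a biarithmetic IASI orients an edge by a non-strict inequality,
  whereas the theorem uses a strict one; since \<open>1 < k\<close> and the smaller index is
  positive, the two agree on edges.\<close>

lemma biarithmetic_edge:
  assumes G: "simple_graph V E" and f: "biarithmetic_iasi V E f" and e: "{u, v} \<in> E"
    and le: "det_index (f u) \<le> det_index (f v)"
  shows "det_index (f u) < det_index (f v)"
    and "card (edge_label f {u, v}) = card (f u) * card (f v) \<longleftrightarrow>
      det_ratio f {u, v} = of_nat (card (f u))"
proof -
  \<comment> \<open>Cardinality 2 rules out \<open>u = v\<close>, for which
    \<open>edge_label\<close> would not be a sumset of two labels.\<close>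
  have "{u, v} \<subseteq> V" "card {u, v} = 2"
    using G e unfolding simple_graph_def by blast+
  then have V: "u \<in> V" "v \<in> V" and neq: "u \<noteq> v" by auto
  have ap: "ap_set (f u)" "ap_set (f v)"
    using f V by (auto simp: biarithmetic_iasi_def arithmetic_iasi_def)
  from f e le obtain k where k: "1 < k" "k \<le> card (f u)"
    and dv: "det_index (f v) = k * det_index (f u)"
    unfolding biarithmetic_iasi_def by blast
  have pu: "is_progression (f u) (det_index (f u))"
    using ap by (simp add: ap_set_is_progression_det_index)
  then have pos: "0 < det_index (f u)" by (simp add: is_progression_def)
  with k dv show "det_index (f u) < det_index (f v)" by simp
  have pv: "is_progression (f v) (k * det_index (f u))"
    using ap_set_is_progression_det_index[OF ap(2)] dv by simp
  have "1 < card (f v)" using ap(2) by (simp add: ap_set_def)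
  with pu pv k have "card (edge_label f {u, v}) = card (f u) * card (f v) \<longleftrightarrow> k = card (f u)"
    unfolding edge_label_doubleton[OF neq]
    by (intro card_sumset_progressions_eq_mult_iff) auto
  moreover have "det_ratio f {u, v} = of_nat k"
    using dv pos k by (intro det_ratio_doubleton) auto
  ultimately show "card (edge_label f {u, v}) = card (f u) * card (f v) \<longleftrightarrow>
      det_ratio f {u, v} = of_nat (card (f u))" by simp
qed

theorem theorem3p9:
  fixes V :: "'a set" and E :: "'a set set" and f :: "'a \<Rightarrow> nat set"
  assumes "simple_graph V E"
    and "biarithmetic_iasi V E f"
  shows "strong_iasi V E f \<longleftrightarrow>
    (\<forall>u v. {u, v} \<in> E \<and> det_index (f u) < det_index (f v) \<longrightarrow>
       det_ratio f {u, v} = of_nat (card (f u)))"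
proof
  assume "strong_iasi V E f"
  then show "\<forall>u v. {u, v} \<in> E \<and> det_index (f u) < det_index (f v) \<longrightarrow>
      det_ratio f {u, v} = of_nat (card (f u))"
    using biarithmetic_edge(2)[OF assms] by (simp add: strong_iasi_def)
next
  assume ratio: "\<forall>u v. {u, v} \<in> E \<and> det_index (f u) < det_index (f v) \<longrightarrow>
      det_ratio f {u, v} = of_nat (card (f u))"
  have oriented: "card (edge_label f {u, v}) = card (f u) * card (f v)"
    if "{u, v} \<in> E" "det_index (f u) \<le> det_index (f v)" for u v
    using biarithmetic_edge[OF assms that] ratio that(1) by blast
  have "card (edge_label f {u, v}) = card (f u) * card (f v)" if e: "{u, v} \<in> E" for u v
  proof (cases "det_index (f u) \<le> det_index (f v)")
    case True
    with e show ?thesis by (rule oriented)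
  next
    \<comment> \<open>\<open>strong_iasi\<close> ranges over both orders of the ends; its condition
      is symmetric, so the ends may be swapped.\<close>
    case False
    with e oriented[of v u] show ?thesis by (simp add: insert_commute mult.commute)
  qed
  moreover have "iasi V E f"
    using assms(2) by (simp add: biarithmetic_iasi_def arithmetic_iasi_def)
  ultimately show "strong_iasi V E f" by (simp add: strong_iasi_def)
qed

end
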